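(* Let $(W,S)$ be a finite Coxeter system with $W$ a dihedral group, i.e. $|S|=2$ (type $I_2(m)$). Then for all $I,J\subset S$ and all $b\in X_{IJ}$, $$|W(I,J,b)|=|W(J,I,b^{-1})|.$$
   Context: $\ell$ is the length function. For $I\subset S$, $W_I$ is the subgroup generated by $I$ and $X_I=\{w\in W:\ell(ws)>\ell(w)\ \forall s\in I\}$. Every $w\in W$ factors uniquely as $w=w^Iw_I$ with $w^I\in X_I$, $w_I\in W_I$. For $I,J\subset S$, $X_{IJ}=X_I^{-1}\cap X_J$ with $X_I^{-1}=\{x^{-1}:x\in X_I\}$. For $b\in X_{IJ}$, $$W(I,J,b)=\{w\in W: w^Jb^{-1}=(wb^{-1})_I\}.$$ *)

theory Defs
  imports "HOL-Algebra.Algebra"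
begin

definition word_eval :: "('a, 'b) monoid_scheme \<Rightarrow> 'a list \<Rightarrow> 'a" where
  "word_eval W ws = foldr (\<otimes>\<^bsub>W\<^esub>) ws \<one>\<^bsub>W\<^esub>"

text \<open>
  The congruence on words over \<open>S\<close> generated by the Coxeter relations \<open>(st)^m(s,t) = 1\<close>, where
  \<open>m(s,t)\<close> is the order of \<open>st\<close> in \<open>W\<close>. HOL-Algebra sets \<open>ord x = 0\<close> for \<open>x\<close> of infinite order, so
  pairs with \<open>m(s,t) = \<infinity>\<close> only contribute the trivial relation. For involutions \<open>s = t\<close> gives
  \<open>s s = 1\<close>, so letters are invertible modulo the congruence and the quotient monoid of words is the
  group presented by these relations; no formal inverses are needed.
\<close>

inductive coxeter_equiv :: "('a, 'b) monoid_scheme \<Rightarrow> 'a set \<Rightarrow> 'a list \<Rightarrow> 'a list \<Rightarrow> bool"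
  for W :: "('a, 'b) monoid_scheme" and S :: "'a set" where
  refl: "u \<in> lists S \<Longrightarrow> coxeter_equiv W S u u"
| sym: "coxeter_equiv W S u v \<Longrightarrow> coxeter_equiv W S v u"
| trans: "coxeter_equiv W S u v \<Longrightarrow> coxeter_equiv W S v w \<Longrightarrow> coxeter_equiv W S u w"
| rel: "u \<in> lists S \<Longrightarrow> v \<in> lists S \<Longrightarrow> s \<in> S \<Longrightarrow> t \<in> S \<Longrightarrow>
    coxeter_equiv W S (u @ concat (replicate (group.ord W (s \<otimes>\<^bsub>W\<^esub> t)) [s, t]) @ v) (u @ v)"

text \<open>
  \<open>S\<close> generates \<open>W\<close>, consists of elements of order 2, and \<open>W\<close> is presented by \<open>S\<close> subject to the
  relations above: words with the same value in \<open>W\<close> are congruent (the converse implication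
  holds automatically).
\<close>

locale coxeter_system = group W for W :: "('a, 'b) monoid_scheme" (structure) +
  fixes S :: "'a set"
  assumes S_subset: "S \<subseteq> carrier W"
    and S_generates: "generate W S = carrier W"
    and S_ord: "s \<in> S \<Longrightarrow> ord s = 2"
    and presentation: "u \<in> lists S \<Longrightarrow> v \<in> lists S \<Longrightarrow> word_eval W u = word_eval W v \<Longrightarrow>
      coxeter_equiv W S u v"

definition len :: "('a, 'b) monoid_scheme \<Rightarrow> 'a set \<Rightarrow> 'a \<Rightarrow> nat" where
  "len W S w = (LEAST n. \<exists>ws \<in> lists S. length ws = n \<and> word_eval W ws = w)"

definition X_set :: "('a, 'b) monoid_scheme \<Rightarrow> 'a set \<Rightarrow> 'a set \<Rightarrow> 'a set" where
  "X_set W S I = {w \<in> carrier W. \<forall>s \<in> I. len W S (w \<otimes>\<^bsub>W\<^esub> s) > len W S w}"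

text \<open>
  The pair \<open>(w^I, w_I)\<close> of the unique factorization \<open>w = w^I w_I\<close> with \<open>w^I \<in> X_I\<close>, \<open>w_I \<in> W_I\<close>.
\<close>

definition par_decomp :: "('a, 'b) monoid_scheme \<Rightarrow> 'a set \<Rightarrow> 'a set \<Rightarrow> 'a \<Rightarrow> 'a \<times> 'a" where
  "par_decomp W S I w =
    (THE p. fst p \<in> X_set W S I \<and> snd p \<in> generate W I \<and> w = fst p \<otimes>\<^bsub>W\<^esub> snd p)"

definition coset_part :: "('a, 'b) monoid_scheme \<Rightarrow> 'a set \<Rightarrow> 'a set \<Rightarrow> 'a \<Rightarrow> 'a" where
  "coset_part W S I w = fst (par_decomp W S I w)"

definition subgroup_part :: "('a, 'b) monoid_scheme \<Rightarrow> 'a set \<Rightarrow> 'a set \<Rightarrow> 'a \<Rightarrow> 'a" where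
  "subgroup_part W S I w = snd (par_decomp W S I w)"

definition X_double :: "('a, 'b) monoid_scheme \<Rightarrow> 'a set \<Rightarrow> 'a set \<Rightarrow> 'a set \<Rightarrow> 'a set" where
  "X_double W S I J = (m_inv W ` X_set W S I) \<inter> X_set W S J"

definition W_set :: "('a, 'b) monoid_scheme \<Rightarrow> 'a set \<Rightarrow> 'a set \<Rightarrow> 'a set \<Rightarrow> 'a \<Rightarrow> 'a set" where
  "W_set W S I J b = {w \<in> carrier W.
    coset_part W S J w \<otimes>\<^bsub>W\<^esub> inv\<^bsub>W\<^esub> b = subgroup_part W S I (w \<otimes>\<^bsub>W\<^esub> inv\<^bsub>W\<^esub> b)}"

end

theory Submission
  imports Defs
begin

text \<open>
  An element \<open>w\<close> of \<open>W(I,J,b)\<close> is the same as a pair \<open>u \<in> W\<^sub>I\<close>, \<open>v \<in> W\<^sub>J\<close> with \<open>w = u b v\<close>,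
  \<open>ub \<in> X\<^sub>J\<close> and \<open>(ub) v (ub)\<^sup>-\<^sup>1 \<in> X\<^sub>I\<close> (lemma \<open>card_W_set\<close>), so these pairs can be counted instead.
  If \<open>I\<close> or \<open>J\<close> is empty, both sides count the parabolic subgroup of the other set. If one of them
  is \<open>S\<close>, then \<open>b = 1\<close> and both sides count the minimal coset representatives for the other set.

  There remains \<open>I = {s}\<close>, \<open>J = {t}\<close>. For two generators a reduced word is an alternating word, so
  an element is determined by its length together with one left descent. This gives first that
  \<open>sb = bt\<close> unless \<open>sb \<in> X\<^sub>J\<close>; if \<open>sb = bt\<close> there is just one pair. Otherwise \<open>r = b t b\<^sup>-\<^sup>1\<close> is a
  reflection different from \<open>s\<close>, the pairs \<open>(1,1)\<close> and \<open>(s,1)\<close> count, and \<open>(1,t)\<close>, \<open>(s,t)\<close> count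
  according to whether \<open>r\<close> and \<open>srs\<close> lie in \<open>X\<^sub>I\<close>. Exactly one of them does, unless \<open>r\<close> and \<open>s\<close>
  commute, when both do (lemma \<open>conj_ascent_iff\<close>). So the number of pairs is 1, 3 or 4, depending
  only on whether \<open>sb = bt\<close> and whether \<open>s\<close> commutes with \<open>b t b\<^sup>-\<^sup>1\<close>. Both conditions are symmetric
  under exchanging \<open>(s, t, b)\<close> with \<open>(t, s, b\<^sup>-\<^sup>1)\<close>.
\<close>

section \<open>Length and descents in a Coxeter system\<close>

context coxeter_system
begin

abbreviation length_fun :: "'a \<Rightarrow> nat" ("\<ell>") where
  "\<ell> w \<equiv> len W S w"

lemma S_closed [simp]: "s \<in> S \<Longrightarrow> s \<in> carrier W"
  using S_subset by blast

lemma S_square [simp]: "s \<in> S \<Longrightarrow> s \<otimes> s = \<one>"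
  using pow_ord_eq_1[of s] S_ord[of s] by (simp add: numeral_2_eq_2)

lemma S_inv [simp]: "s \<in> S \<Longrightarrow> inv s = s"
  using inv_equality[of s s] by simp

lemma S_cancel_left [simp]: "s \<in> S \<Longrightarrow> x \<in> carrier W \<Longrightarrow> s \<otimes> (s \<otimes> x) = x"
  by (simp add: m_assoc[symmetric])

lemma S_cancel_right [simp]: "s \<in> S \<Longrightarrow> x \<in> carrier W \<Longrightarrow> x \<otimes> s \<otimes> s = x"
  by (simp add: m_assoc)

lemma word_eval_Nil [simp]: "word_eval W [] = \<one>"
  by (simp add: word_eval_def)

lemma word_eval_Cons [simp]: "word_eval W (a # ws) = a \<otimes> word_eval W ws"
  by (simp add: word_eval_def)

lemma word_eval_closed [simp]: "ws \<in> lists S \<Longrightarrow> word_eval W ws \<in> carrier W"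
  by (induction ws) auto

lemma word_eval_append:
  "u \<in> lists S \<Longrightarrow> v \<in> lists S \<Longrightarrow> word_eval W (u @ v) = word_eval W u \<otimes> word_eval W v"
  by (induction u) (auto simp: m_assoc)

lemma word_eval_rev: "ws \<in> lists S \<Longrightarrow> word_eval W (rev ws) = inv (word_eval W ws)"
  by (induction ws) (auto simp: word_eval_append inv_mult_group in_lists_conv_set)

lemma ex_word:
  assumes "w \<in> carrier W"
  shows "\<exists>ws \<in> lists S. word_eval W ws = w"
proof -
  have "w \<in> generate W S"
    using assms S_generates by simp
  then show ?thesis
  proof (induction rule: generate.induct)
    case one
    show ?case by (rule bexI[of _ "[]"]) auto
  next
    case (incl s)
    then show ?case by (intro bexI[of _ "[s]"]) auto
  next
    case (inv s)
    then show ?case by (intro bexI[of _ "[s]"]) auto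
  next
    case (eng x y)
    then obtain u v where "u \<in> lists S" "v \<in> lists S" "word_eval W u = x" "word_eval W v = y"
      by blast
    then show ?case by (intro bexI[of _ "u @ v"]) (auto simp: word_eval_append)
  qed
qed

lemma ex_reduced_word:
  assumes "w \<in> carrier W"
  obtains ws where "ws \<in> lists S" "length ws = \<ell> w" "word_eval W ws = w"
proof -
  have "\<exists>n. \<exists>ws \<in> lists S. length ws = n \<and> word_eval W ws = w"
    using ex_word[OF assms] by blast
  from LeastI_ex[OF this] show ?thesis
    using that unfolding len_def by blast
qed

lemma len_word_le: "ws \<in> lists S \<Longrightarrow> \<ell> (word_eval W ws) \<le> length ws"
  unfolding len_def by (rule Least_le) blast

lemma len_one [simp]: "\<ell> \<one> = 0"
  using len_word_le[of "[]"] by simp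

lemma len_mult_le:
  assumes "x \<in> carrier W" "y \<in> carrier W"
  shows "\<ell> (x \<otimes> y) \<le> \<ell> x + \<ell> y"
proof -
  obtain u where u: "u \<in> lists S" "length u = \<ell> x" "word_eval W u = x"
    using ex_reduced_word[OF assms(1)] .
  obtain v where v: "v \<in> lists S" "length v = \<ell> y" "word_eval W v = y"
    using ex_reduced_word[OF assms(2)] .
  show ?thesis
    using len_word_le[of "u @ v"] u v by (simp add: word_eval_append)
qed

lemma len_inv [simp]:
  assumes "x \<in> carrier W"
  shows "\<ell> (inv x) = \<ell> x"
proof -
  have le: "\<ell> (inv y) \<le> \<ell> y" if y: "y \<in> carrier W" for y
  proof -
    obtain u where u: "u \<in> lists S" "length u = \<ell> y" "word_eval W u = y"
      using ex_reduced_word[OF y] .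
    have "rev u \<in> lists S" using u(1) by auto
    then show ?thesis
      using len_word_le[of "rev u"] u by (simp add: word_eval_rev)
  qed
  show ?thesis
    using le[OF assms] le[of "inv x"] assms by simp
qed

text \<open>
  Each defining relator \<open>(st)^m\<close> has even length. So the parity of a word depends only on its
  value: this is the sign character of \<open>W\<close>.
\<close>

lemma coxeter_equiv_parity: "coxeter_equiv W S u v \<Longrightarrow> even (length u) = even (length v)"
proof (induction rule: coxeter_equiv.induct)
  case (rel u v s t)
  have "length (concat (replicate n [s, t])) = 2 * n" for n
    by (induction n) auto
  then show ?case by simp
qed auto

lemma even_len_word:
  assumes "ws \<in> lists S"
  shows "even (\<ell> (word_eval W ws)) = even (length ws)"
proof -
  obtain u where u: "u \<in> lists S" "length u = \<ell> (word_eval W ws)" "word_eval W u = word_eval W ws"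
    using ex_reduced_word word_eval_closed[OF assms] .
  then show ?thesis
    using coxeter_equiv_parity[OF presentation[OF u(1) assms u(3)]] by simp
qed

lemma even_len_mult:
  assumes "x \<in> carrier W" "y \<in> carrier W"
  shows "even (\<ell> (x \<otimes> y)) \<longleftrightarrow> even (\<ell> x) = even (\<ell> y)"
proof -
  obtain u where u: "u \<in> lists S" "length u = \<ell> x" "word_eval W u = x"
    using ex_reduced_word[OF assms(1)] .
  obtain v where v: "v \<in> lists S" "length v = \<ell> y" "word_eval W v = y"
    using ex_reduced_word[OF assms(2)] .
  show ?thesis
    using even_len_word[of "u @ v"] u v by (auto simp: word_eval_append)
qed

lemma len_generator [simp]:
  assumes "s \<in> S"
  shows "\<ell> s = 1"
proof -
  have "\<ell> s \<le> 1" using len_word_le[of "[s]"] assms by simp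
  moreover have "odd (\<ell> s)" using even_len_word[of "[s]"] assms by simp
  ultimately show ?thesis by (cases "\<ell> s") auto
qed

text \<open>By parity, multiplying by a generator never preserves the length.\<close>

lemma len_mult_right:
  assumes "x \<in> carrier W" "s \<in> S"
  shows "\<ell> (x \<otimes> s) = \<ell> x + 1 \<or> \<ell> x = \<ell> (x \<otimes> s) + 1"
proof -
  have "\<ell> (x \<otimes> s) \<le> \<ell> x + 1" "\<ell> x \<le> \<ell> (x \<otimes> s) + 1"
    using len_mult_le[of x s] len_mult_le[of "x \<otimes> s" s] assms by simp_all
  moreover have "\<ell> (x \<otimes> s) \<noteq> \<ell> x"
    using even_len_mult[of x s] assms by auto
  ultimately show ?thesis by linarith
qed

lemma len_mult_left:
  assumes "x \<in> carrier W" "s \<in> S"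
  shows "\<ell> (s \<otimes> x) = \<ell> x + 1 \<or> \<ell> x = \<ell> (s \<otimes> x) + 1"
proof -
  have "\<ell> (s \<otimes> x) = \<ell> (inv x \<otimes> s)"
    using len_inv[of "s \<otimes> x"] assms by (simp add: inv_mult_group)
  then show ?thesis
    using len_mult_right[of "inv x" s] assms by simp
qed

lemma ex_left_descent:
  assumes "x \<in> carrier W" "x \<noteq> \<one>"
  shows "\<exists>s \<in> S. \<ell> (s \<otimes> x) < \<ell> x"
proof -
  obtain u where u: "u \<in> lists S" "length u = \<ell> x" "word_eval W u = x"
    using ex_reduced_word[OF assms(1)] .
  then obtain s v where v: "u = s # v"
    using assms(2) by (cases u) auto
  then have "s \<in> S" "v \<in> lists S" using u(1) by auto
  moreover have "s \<otimes> x = word_eval W v"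
    using u(3) v calculation by (auto simp: in_lists_conv_set)
  ultimately show ?thesis
    using len_word_le[of v] u(2) v by (intro bexI[of _ s]) auto
qed

lemma ex_right_descent:
  assumes "x \<in> carrier W" "x \<noteq> \<one>"
  shows "\<exists>s \<in> S. \<ell> (x \<otimes> s) < \<ell> x"
proof -
  have "inv x \<noteq> \<one>" using assms by simp
  then obtain s where s: "s \<in> S" "\<ell> (s \<otimes> inv x) < \<ell> (inv x)"
    using ex_left_descent[of "inv x"] assms by auto
  have "\<ell> (s \<otimes> inv x) = \<ell> (x \<otimes> s)"
    using len_inv[of "s \<otimes> inv x"] s(1) assms by (simp add: inv_mult_group)
  then show ?thesis using s assms by auto
qed

lemma X_set_closed: "x \<in> X_set W S I \<Longrightarrow> x \<in> carrier W"
  by (simp add: X_set_def)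

lemma one_in_X_set: "I \<subseteq> S \<Longrightarrow> \<one> \<in> X_set W S I"
  by (auto simp: X_set_def)

lemma X_set_empty: "X_set W S {} = carrier W"
  by (simp add: X_set_def)

lemma X_set_full: "X_set W S S = {\<one>}"
  using ex_right_descent one_in_X_set[of S] by (force simp: X_set_def)

lemma generate_closed: "I \<subseteq> S \<Longrightarrow> u \<in> generate W I \<Longrightarrow> u \<in> carrier W"
  using generate_in_carrier[of I u] S_subset by blast

lemma generate_singleton:
  assumes "s \<in> S"
  shows "generate W {s} = {\<one>, s}"
proof
  have "subgroup {\<one>, s} W"
    using assms by (intro subgroupI) auto
  then show "generate W {s} \<subseteq> {\<one>, s}"
    by (intro generate_subgroup_incl) auto
  show "{\<one>, s} \<subseteq> generate W {s}"
    by (auto intro: generate.intros)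
qed

lemma X_doubleD:
  assumes "b \<in> X_double W S I J"
  shows "b \<in> X_set W S J" "inv b \<in> X_set W S I" "b \<in> carrier W"
  using assms by (auto simp: X_double_def X_set_def)

lemma X_double_inv:
  assumes "b \<in> X_double W S I J"
  shows "inv b \<in> X_double W S J I"
  using X_doubleD[OF assms] by (auto simp: X_double_def intro!: image_eqI[of _ _ b])

end


section \<open>Descents in a dihedral Coxeter system\<close>

locale dihedral_system = coxeter_system +
  assumes card_S: "card S = 2"
begin

lemma other_generator_unique:
  "a \<in> S \<Longrightarrow> a' \<in> S \<Longrightarrow> b \<in> S \<Longrightarrow> a \<noteq> b \<Longrightarrow> a' \<noteq> b \<Longrightarrow> a = a'"
  using card_S by (auto simp: card_2_iff)

text \<open>
  A reduced word in two involutions alternates, so it is determined by its first letter and its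
  number of letters. The induction strips that first letter \<open>a\<close>; the rest can then only start with
  the other generator.
\<close>

lemma eq_if_same_left_descent:
  assumes "x \<in> carrier W" "y \<in> carrier W" "a \<in> S"
    and "\<ell> (a \<otimes> x) < \<ell> x" "\<ell> (a \<otimes> y) < \<ell> y" "\<ell> x = \<ell> y"
  shows "x = y"
  using assms
proof (induction "\<ell> x" arbitrary: x y a rule: less_induct)
  case less
  define x' y' where "x' = a \<otimes> x" and "y' = a \<otimes> y"
  have x': "x' \<in> carrier W" "x = a \<otimes> x'" "\<ell> x = \<ell> x' + 1"
    using less.prems len_mult_left[of x a] by (auto simp: x'_def)
  have y': "y' \<in> carrier W" "y = a \<otimes> y'" "\<ell> y = \<ell> y' + 1"
    using less.prems len_mult_left[of y a] by (auto simp: y'_def)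
  have "x' = y'"
  proof (cases "x' = \<one> \<or> y' = \<one>")
    case True
    then have "\<ell> x' = 0" "\<ell> y' = 0"
      using x' y' less.prems by auto
    then show ?thesis
      using ex_left_descent[of x'] ex_left_descent[of y'] x' y' by auto
  next
    case False
    then obtain c where c: "c \<in> S" "\<ell> (c \<otimes> x') < \<ell> x'"
      using ex_left_descent[of x'] x'(1) by blast
    obtain d where d: "d \<in> S" "\<ell> (d \<otimes> y') < \<ell> y'"
      using False ex_left_descent[of y'] y'(1) by blast
    have "c \<noteq> a" "d \<noteq> a"
      using c d x' y' by auto
    then have "c = d"
      using other_generator_unique c d less.prems by blast
    then show ?thesis
      using less.hyps[of x' y' c] c d x' y' less.prems by simp
  qed
  then show ?case using x' y' by simp
qed

text \<open>
  An alternating word that starts with \<open>a\<close> ends with \<open>a\<close> if its length is odd and with the other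
  generator if its length is even. The longest element has both generators as descents, so the
  last letter is some right descent, and not always the only one.
\<close>

lemma right_descent_of_left_descent:
  assumes "x \<in> carrier W" "a \<in> S" "\<ell> (a \<otimes> x) < \<ell> x"
    and "c \<in> S" "c = a \<longleftrightarrow> odd (\<ell> x)"
  shows "\<ell> (x \<otimes> c) < \<ell> x"
  using assms
proof (induction "\<ell> x" arbitrary: x a rule: less_induct)
  case less
  define y where "y = a \<otimes> x"
  have y: "y \<in> carrier W" "x = a \<otimes> y" "\<ell> x = \<ell> y + 1"
    using less.prems len_mult_left[of x a] by (auto simp: y_def)
  show ?case
  proof (cases "y = \<one>")
    case True
    then show ?thesis using y less.prems by simp
  next
    case False
    then obtain d where d: "d \<in> S" "\<ell> (d \<otimes> y) < \<ell> y"
      using ex_left_descent y by blast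
    then have "d \<noteq> a" using y by auto
    then have "c = d \<longleftrightarrow> c \<noteq> a"
      using other_generator_unique d less.prems by blast
    then have "\<ell> (y \<otimes> c) < \<ell> y"
      using less.hyps[of y d] d y less.prems by auto
    moreover have "\<ell> (x \<otimes> c) \<le> 1 + \<ell> (y \<otimes> c)"
      using len_mult_le[of a "y \<otimes> c"] y less.prems by (simp add: m_assoc)
    ultimately show ?thesis using y by simp
  qed
qed

lemma odd_descent_iff:
  assumes x: "x \<in> carrier W" and a: "a \<in> S" and odd: "odd (\<ell> x)"
  shows "\<ell> (x \<otimes> a) < \<ell> x \<longleftrightarrow> \<ell> (a \<otimes> x) < \<ell> x"
proof
  show "\<ell> (a \<otimes> x) < \<ell> x \<Longrightarrow> \<ell> (x \<otimes> a) < \<ell> x"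
    using right_descent_of_left_descent[of x a a] assms by simp
  have "\<ell> (a \<otimes> inv x) = \<ell> (x \<otimes> a)" "\<ell> (inv x \<otimes> a) = \<ell> (a \<otimes> x)"
    using len_inv[of "x \<otimes> a"] len_inv[of "a \<otimes> x"] assms by (simp_all add: inv_mult_group)
  then show "\<ell> (x \<otimes> a) < \<ell> x \<Longrightarrow> \<ell> (a \<otimes> x) < \<ell> x"
    using right_descent_of_left_descent[of "inv x" a a] assms by simp
qed

text \<open>
  Conjugating the alternating word of a reflection by \<open>s\<close> either strips an \<open>s\<close> from both ends or
  adds one at both ends, so it exchanges the two kinds of reflections. The exceptions are \<open>s\<close>
  itself and the reflections \<open>r\<close> that commute with \<open>s\<close>: as \<open>srs = r\<close> is not shorter than \<open>r\<close>, no
  \<open>s\<close> can be stripped, so \<open>s\<close> is not a descent of \<open>r\<close>. The property of a reflection that makes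
  this work is its odd length, by which its word has the same letter at both ends.
\<close>

lemma conj_ascent_if_descent:
  assumes r: "r \<in> carrier W" "odd (\<ell> r)" "r \<noteq> s" and s: "s \<in> S"
    and desc: "\<ell> (r \<otimes> s) < \<ell> r"
  shows "\<ell> (s \<otimes> r \<otimes> s) < \<ell> (s \<otimes> r)"
proof -
  have less: "\<ell> (s \<otimes> r) < \<ell> r"
    using odd_descent_iff[of r s] assms by simp
  define x where "x = s \<otimes> r"
  have x: "x \<in> carrier W" "r = s \<otimes> x" "\<ell> r = \<ell> x + 1"
    using less r s len_mult_left[of r s] by (auto simp: x_def)
  have "x \<noteq> \<one>" using x r s by auto
  then obtain d where d: "d \<in> S" "\<ell> (d \<otimes> x) < \<ell> x"
    using ex_left_descent x by blast
  then have "d \<noteq> s" using x by auto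
  moreover have "even (\<ell> x)" using r(2) x(3) by simp
  ultimately have "\<ell> (x \<otimes> s) < \<ell> x"
    using right_descent_of_left_descent[OF x(1) d s] by simp
  then show "\<ell> (s \<otimes> r \<otimes> s) < \<ell> (s \<otimes> r)"
    by (simp only: x_def)
qed

lemma conj_eq_if_both_ascents:
  assumes r: "r \<in> carrier W" "odd (\<ell> r)" and s: "s \<in> S"
    and asc: "\<ell> r < \<ell> (r \<otimes> s)" "\<ell> (s \<otimes> r \<otimes> s) < \<ell> (s \<otimes> r)"
  shows "s \<otimes> r \<otimes> s = r"
proof -
  define q where "q = s \<otimes> r \<otimes> s"
  have q: "q \<in> carrier W" "q \<otimes> s = s \<otimes> r" "s \<otimes> q = r \<otimes> s"
    using r s by (auto simp: q_def m_assoc)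
  have odd_q: "odd (\<ell> q)"
    using even_len_mult[of "s \<otimes> r" s] even_len_mult[of s r] r s by (auto simp: q_def)
  have "\<not> \<ell> (s \<otimes> r) < \<ell> r"
    using odd_descent_iff[of r s] r s asc by auto
  moreover have "\<not> \<ell> (s \<otimes> q) < \<ell> q"
    using odd_descent_iff[of q s] q s odd_q asc by (auto simp: q_def)
  moreover have len: "\<ell> q = \<ell> r"
    using len_mult_left[of r s] len_mult_right[of "s \<otimes> r" s] calculation(1) asc r s
    by (auto simp: q_def)
  moreover have "r \<noteq> \<one>" "q \<noteq> \<one>"
    using r odd_q by auto
  then obtain c where c: "c \<in> S" "\<ell> (c \<otimes> r) < \<ell> r"
    using ex_left_descent[of r] r(1) by blast
  moreover obtain d where d: "d \<in> S" "\<ell> (d \<otimes> q) < \<ell> q"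
    using \<open>q \<noteq> \<one>\<close> ex_left_descent[of q] q(1) by blast
  ultimately have "c \<noteq> s" "d \<noteq> s" by auto
  then have "c = d"
    using other_generator_unique c d s by blast
  then show ?thesis
    using eq_if_same_left_descent[of q r c] c d q r len by (simp add: q_def)
qed

lemma conj_ascent_iff:
  assumes r: "r \<in> carrier W" "odd (\<ell> r)" "r \<noteq> s" and s: "s \<in> S"
  shows "\<ell> (s \<otimes> r \<otimes> s) < \<ell> (s \<otimes> r) \<longleftrightarrow> \<ell> (r \<otimes> s) < \<ell> r \<or> s \<otimes> r = r \<otimes> s"
    and "s \<otimes> r = r \<otimes> s \<Longrightarrow> \<ell> r < \<ell> (r \<otimes> s)"
proof -
  have cd: "\<ell> r < \<ell> (r \<otimes> s) \<longleftrightarrow> \<not> \<ell> (r \<otimes> s) < \<ell> r"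
    using len_mult_right[of r s] r s by auto
  have comm: "s \<otimes> r \<otimes> s = r \<longleftrightarrow> s \<otimes> r = r \<otimes> s"
    using r s S_cancel_right[of s "s \<otimes> r"] S_cancel_right[of s r] by (metis m_closed S_closed)
  show asc: "\<ell> r < \<ell> (r \<otimes> s)" if c: "s \<otimes> r = r \<otimes> s"
    using conj_ascent_if_descent[OF r s] comm c cd by fastforce
  show "\<ell> (s \<otimes> r \<otimes> s) < \<ell> (s \<otimes> r) \<longleftrightarrow> \<ell> (r \<otimes> s) < \<ell> r \<or> s \<otimes> r = r \<otimes> s"
    using conj_ascent_if_descent[OF r s] conj_eq_if_both_ascents[OF r(1,2) s] asc comm cd by metis
qed

text \<open>
  If \<open>sbt\<close> is not longer than \<open>sb\<close>, then \<open>sb\<close> and \<open>bt\<close> have the same length and the same left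
  descent \<open>s\<close>.
\<close>

lemma double_coset_ascent:
  assumes b: "b \<in> carrier W" and s: "s \<in> S" and t: "t \<in> S"
    and asc: "\<ell> b < \<ell> (s \<otimes> b)" "\<ell> b < \<ell> (b \<otimes> t)"
  shows "\<ell> (s \<otimes> b) < \<ell> (s \<otimes> b \<otimes> t) \<longleftrightarrow> s \<otimes> b \<noteq> b \<otimes> t"
proof
  show "\<ell> (s \<otimes> b) < \<ell> (s \<otimes> b \<otimes> t) \<Longrightarrow> s \<otimes> b \<noteq> b \<otimes> t"
    using asc b t by auto
  have "s \<otimes> b = b \<otimes> t" if "\<not> \<ell> (s \<otimes> b) < \<ell> (s \<otimes> b \<otimes> t)"
  proof (rule eq_if_same_left_descent[of _ _ s])
    have "\<ell> (s \<otimes> b) = \<ell> b + 1" "\<ell> (b \<otimes> t) = \<ell> b + 1"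
      using asc len_mult_left[of b s] len_mult_right[of b t] b s t by auto
    moreover have "\<ell> (s \<otimes> b) = \<ell> (s \<otimes> b \<otimes> t) + 1"
      using that len_mult_right[of "s \<otimes> b" t] b s t by auto
    ultimately show "\<ell> (s \<otimes> (b \<otimes> t)) < \<ell> (b \<otimes> t)" "\<ell> (s \<otimes> b) = \<ell> (b \<otimes> t)"
      "\<ell> (s \<otimes> (s \<otimes> b)) < \<ell> (s \<otimes> b)"
      using b s t by (auto simp: m_assoc)
  qed (use b s t in auto)
  then show "s \<otimes> b \<noteq> b \<otimes> t \<Longrightarrow> \<ell> (s \<otimes> b) < \<ell> (s \<otimes> b \<otimes> t)"
    by blast
qed

section \<open>Parabolic factorization and the sets \<open>W(I,J,b)\<close>\<close>

lemma subset_S_cases: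
  assumes "I \<subseteq> S"
  obtains "I = {}" | "I = S" | s where "s \<in> S" "I = {s}"
proof -
  have "finite S" using card_S card.infinite by fastforce
  then have "card I \<le> 2" using assms card_S card_mono by fastforce
  then consider "card I = 0" | "card I = 1" | "card I = 2" by linarith
  then show thesis
  proof cases
    case 1
    then show thesis using that(1) \<open>finite S\<close> assms finite_subset by fastforce
  next
    case 2
    then show thesis using that(3) assms by (auto simp: card_1_singleton_iff)
  next
    case 3
    then show thesis using that(2) \<open>finite S\<close> assms card_S card_subset_eq by metis
  qed
qed

lemma ex1_factorization:
  assumes I: "I \<subseteq> S" and w: "w \<in> carrier W"
  shows "\<exists>!p. fst p \<in> X_set W S I \<and> snd p \<in> generate W I \<and> w = fst p \<otimes> snd p"
  using I
proof (cases rule: subset_S_cases)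
  case 1
  then show ?thesis
    using w by (intro ex1I[of _ "(w, \<one>)"]) (auto simp: X_set_empty generate_empty)
next
  case 2
  then show ?thesis
    using w S_generates by (intro ex1I[of _ "(\<one>, w)"]) (auto simp: X_set_full)
next
  case (3 s)
  have gen: "generate W I = {\<one>, s}" using 3 generate_singleton by simp
  have X: "x \<in> X_set W S I \<longleftrightarrow> x \<in> carrier W \<and> \<ell> x < \<ell> (x \<otimes> s)" for x
    using 3 by (auto simp: X_set_def)
  \<comment> \<open>Exactly one element of the coset \<open>{w, ws}\<close> is shorter than the other.\<close>
  show ?thesis
  proof (cases "\<ell> w < \<ell> (w \<otimes> s)")
    case True
    then show ?thesis
      using w 3(1) unfolding X gen
      by (intro ex1I[of _ "(w, \<one>)"]) auto
  next
    case False
    then have "\<ell> (w \<otimes> s) < \<ell> w" using len_mult_right[of w s] w 3 by auto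
    then show ?thesis
      using w 3(1) unfolding X gen
      by (intro ex1I[of _ "(w \<otimes> s, s)"]) auto
  qed
qed

lemma par_decomp_eq:
  assumes "I \<subseteq> S" "x \<in> X_set W S I" "u \<in> generate W I"
  shows "par_decomp W S I (x \<otimes> u) = (x, u)"
proof -
  have "x \<otimes> u \<in> carrier W"
    using assms X_set_closed generate_closed by blast
  from the1_equality[OF ex1_factorization[OF assms(1) this], of "(x, u)"] show ?thesis
    using assms by (simp add: par_decomp_def)
qed

lemma ex_factorization:
  assumes "I \<subseteq> S" "w \<in> carrier W"
  obtains x u where "x \<in> X_set W S I" "u \<in> generate W I" "w = x \<otimes> u"
  using ex1_implies_ex[OF ex1_factorization[OF assms]] by auto

text \<open>The factorizations \<open>w = u b v\<close> of the elements \<open>w\<close> of \<open>W(I,J,b)\<close>.\<close>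

definition factor_pairs :: "'a set \<Rightarrow> 'a set \<Rightarrow> 'a \<Rightarrow> ('a \<times> 'a) set" where
  "factor_pairs I J b = {(u, v). u \<in> generate W I \<and> v \<in> generate W J \<and>
    u \<otimes> b \<in> X_set W S J \<and> (u \<otimes> b) \<otimes> v \<otimes> inv (u \<otimes> b) \<in> X_set W S I}"

text \<open>
  For \<open>w = w\<^sup>J v\<close> the condition defining \<open>W(I,J,b)\<close> says that \<open>u = w\<^sup>J b\<^sup>-\<^sup>1\<close> is the
  \<open>W\<^sub>I\<close>-part of \<open>w b\<^sup>-\<^sup>1\<close>. Then \<open>w = u b v\<close>, and the complementary part of \<open>w b\<^sup>-\<^sup>1\<close> is
  \<open>w b\<^sup>-\<^sup>1 u\<^sup>-\<^sup>1 = (ub) v (ub)\<^sup>-\<^sup>1\<close>.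
\<close>

lemma card_W_set:
  assumes I: "I \<subseteq> S" and J: "J \<subseteq> S" and b: "b \<in> carrier W"
  shows "card (W_set W S I J b) = card (factor_pairs I J b)"
proof -
  let ?f = "\<lambda>(u, v). (u \<otimes> b) \<otimes> v"
  have conj: "(u \<otimes> b) \<otimes> v \<otimes> inv b = ((u \<otimes> b) \<otimes> v \<otimes> inv (u \<otimes> b)) \<otimes> u"
    if "u \<in> carrier W" "v \<in> carrier W" for u v
    using that b by (simp add: m_assoc inv_mult_group)
  have "W_set W S I J b = ?f ` factor_pairs I J b"
  proof (intro equalityI subsetI)
    fix w assume "w \<in> W_set W S I J b"
    then have w: "w \<in> carrier W"
      and eq: "coset_part W S J w \<otimes> inv b = subgroup_part W S I (w \<otimes> inv b)"
      by (auto simp: W_set_def)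
    obtain x v where x: "x \<in> X_set W S J" and v: "v \<in> generate W J" and wxv: "w = x \<otimes> v"
      using ex_factorization[OF J w] .
    obtain y u where y: "y \<in> X_set W S I" and u: "u \<in> generate W I" and wyu: "w \<otimes> inv b = y \<otimes> u"
      using ex_factorization[OF I] w b by (metis inv_closed m_closed)
    note carr = w b X_set_closed[OF x] generate_closed[OF J v] X_set_closed[OF y]
      generate_closed[OF I u]
    have "x \<otimes> inv b = u"
      using eq par_decomp_eq[OF J x v] par_decomp_eq[OF I y u] wxv wyu
      by (simp add: coset_part_def subgroup_part_def)
    then have xub: "x = u \<otimes> b"
      using carr by (metis inv_solve_right)
    have "y \<otimes> u = ((u \<otimes> b) \<otimes> v \<otimes> inv (u \<otimes> b)) \<otimes> u"
      using conj[of u v] wyu wxv xub carr by simp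
    then have "y = (u \<otimes> b) \<otimes> v \<otimes> inv (u \<otimes> b)"
      using carr by (metis inv_closed m_closed r_cancel)
    then have "(u, v) \<in> factor_pairs I J b"
      using x y u v xub by (simp add: factor_pairs_def)
    then show "w \<in> ?f ` factor_pairs I J b"
      using wxv xub by (intro image_eqI[of _ _ "(u, v)"]) auto
  next
    fix w assume "w \<in> ?f ` factor_pairs I J b"
    then obtain u v where uv: "u \<in> generate W I" "v \<in> generate W J" "u \<otimes> b \<in> X_set W S J"
      "(u \<otimes> b) \<otimes> v \<otimes> inv (u \<otimes> b) \<in> X_set W S I" and w: "w = (u \<otimes> b) \<otimes> v"
      by (auto simp: factor_pairs_def)
    have carr: "u \<in> carrier W" "v \<in> carrier W"
      using uv generate_closed I J by auto
    have "coset_part W S J w = u \<otimes> b"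
      using par_decomp_eq[OF J uv(3,2)] w by (simp add: coset_part_def)
    moreover have "subgroup_part W S I (w \<otimes> inv b) = u"
      using par_decomp_eq[OF I uv(4,1)] w conj[OF carr] by (simp add: subgroup_part_def)
    ultimately show "w \<in> W_set W S I J b"
      using w carr b by (simp add: W_set_def m_assoc)
  qed
  moreover have "inj_on ?f (factor_pairs I J b)"
  proof (rule inj_onI, clarify)
    fix u v u' v'
    assume p: "(u, v) \<in> factor_pairs I J b" "(u', v') \<in> factor_pairs I J b"
      and eq: "(u \<otimes> b) \<otimes> v = (u' \<otimes> b) \<otimes> v'"
    have "(u \<otimes> b, v) = (u' \<otimes> b, v')"
      using par_decomp_eq[OF J, of "u \<otimes> b" v] par_decomp_eq[OF J, of "u' \<otimes> b" v'] p
      unfolding factor_pairs_def eq by auto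
    then show "u = u' \<and> v = v'"
      using p b generate_closed[OF I] by (auto simp: factor_pairs_def)
  qed
  ultimately show ?thesis by (simp add: card_image)
qed


section \<open>Counting factor pairs\<close>

lemma factor_pairs_empty_left:
  assumes "J \<subseteq> S" "b \<in> X_set W S J"
  shows "factor_pairs {} J b = {\<one>} \<times> generate W J"
  using assms X_set_closed[OF assms(2)] generate_closed[OF assms(1)]
  by (auto simp: factor_pairs_def X_set_empty generate_empty)

lemma factor_pairs_empty_right:
  assumes "I \<subseteq> S" "b \<in> carrier W"
  shows "factor_pairs I {} b = generate W I \<times> {\<one>}"
  using assms generate_closed[OF assms(1)] one_in_X_set[OF assms(1)]
  by (auto simp: factor_pairs_def X_set_empty generate_empty)

lemma factor_pairs_full_left:
  assumes "J \<subseteq> S"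
  shows "factor_pairs S J \<one> = X_set W S J \<times> {\<one>}"
proof -
  have "x \<otimes> v \<otimes> inv x = \<one> \<longleftrightarrow> v = \<one>" if "x \<in> carrier W" "v \<in> carrier W" for x v
    using that inv_solve_right[of \<one> "x \<otimes> v" x] by auto
  then show ?thesis
    using assms generate_closed[OF assms] X_set_closed[of _ J] S_generates
    by (auto simp: factor_pairs_def X_set_full intro: generate.one)
qed

lemma factor_pairs_full_right:
  assumes "I \<subseteq> S"
  shows "factor_pairs I S \<one> = {\<one>} \<times> X_set W S I"
  using assms generate_closed[OF assms] X_set_closed[of _ I] S_generates
  by (auto simp: factor_pairs_def X_set_full intro: generate.one)

text \<open>
  If \<open>sb = bt\<close>, only the trivial pair counts. Otherwise both pairs \<open>(u,1)\<close> count, and \<open>(u,t)\<close>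
  counts when \<open>u r u\<^sup>-\<^sup>1\<close> has no descent \<open>s\<close>, where \<open>r = b t b\<^sup>-\<^sup>1 \<noteq> s\<close> is a reflection: this is the
  case for one \<open>u\<close> in \<open>{1, s}\<close> in general, and for both of them if \<open>r\<close> commutes with \<open>s\<close>.
\<close>

lemma card_factor_pairs_singletons:
  assumes s: "s \<in> S" and t: "t \<in> S" and bX: "b \<in> X_double W S {s} {t}"
  shows "card (factor_pairs {s} {t} b) =
    (if s \<otimes> b = b \<otimes> t then 1
     else if s \<otimes> (b \<otimes> t \<otimes> inv b) = (b \<otimes> t \<otimes> inv b) \<otimes> s then 4 else 3)"
proof -
  define r where "r = b \<otimes> t \<otimes> inv b"
  have b: "b \<in> carrier W" using X_doubleD[OF bX] by simp
  have bt: "\<ell> b < \<ell> (b \<otimes> t)"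
    using X_doubleD[OF bX] by (simp add: X_set_def)
  have sb: "\<ell> b < \<ell> (s \<otimes> b)"
    using X_doubleD(2)[OF bX] len_inv[of "s \<otimes> b"] s b by (simp add: X_set_def inv_mult_group)
  have r: "r \<in> carrier W" "odd (\<ell> r)"
    using b t even_len_mult[of "b \<otimes> t" "inv b"] even_len_mult[of b t] by (auto simp: r_def)
  have rs: "r = s \<longleftrightarrow> s \<otimes> b = b \<otimes> t"
    unfolding r_def using b s t by (metis S_closed inv_solve_right m_closed)
  have conj_s: "(s \<otimes> b) \<otimes> t \<otimes> inv (s \<otimes> b) = s \<otimes> r \<otimes> s"
    using b s t by (simp add: r_def inv_mult_group m_assoc)
  have neq: "s \<noteq> \<one>" "t \<noteq> \<one>"
    using len_generator[OF s] len_generator[OF t] by auto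
  have mem: "(u, v) \<in> factor_pairs {s} {t} b \<longleftrightarrow> u \<in> {\<one>, s} \<and> v \<in> {\<one>, t} \<and>
      (u = s \<longrightarrow> s \<otimes> b \<noteq> b \<otimes> t) \<and>
      (v = t \<longrightarrow> (if u = s then \<ell> (s \<otimes> r \<otimes> s) < \<ell> (s \<otimes> r) else \<ell> r < \<ell> (r \<otimes> s)))" for u v
    using b s t r neq bt double_coset_ascent[OF b s t sb bt] conj_s
    by (auto simp: factor_pairs_def generate_singleton X_set_def r_def[symmetric])
  show ?thesis
  proof (cases "s \<otimes> b = b \<otimes> t")
    case True
    then have "r = s" using rs by simp
    then have "\<not> \<ell> r < \<ell> (r \<otimes> s)" using s by simp
    then have "factor_pairs {s} {t} b = {(\<one>, \<one>)}"
      using True neq by (auto simp: mem)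
    then show ?thesis using True by simp
  next
    case False
    then have "r \<noteq> s" using rs by simp
    note asc = conj_ascent_iff[OF r this s]
    have dich: "\<ell> r < \<ell> (r \<otimes> s) \<longleftrightarrow> \<not> \<ell> (r \<otimes> s) < \<ell> r"
      using len_mult_right[of r s] r s by auto
    consider (comm) "s \<otimes> r = r \<otimes> s" | (up) "s \<otimes> r \<noteq> r \<otimes> s" "\<ell> r < \<ell> (r \<otimes> s)"
      | (down) "s \<otimes> r \<noteq> r \<otimes> s" "\<not> \<ell> r < \<ell> (r \<otimes> s)"
      by blast
    then show ?thesis
    proof cases
      case comm
      have "\<ell> (s \<otimes> r \<otimes> s) < \<ell> (s \<otimes> r)" "\<ell> r < \<ell> (r \<otimes> s)"
        using asc comm by blast+
      then have "factor_pairs {s} {t} b = {(\<one>, \<one>), (s, \<one>), (\<one>, t), (s, t)}"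
        using False neq by (auto simp: mem)
      then show ?thesis using False neq comm by (simp add: r_def)
    next
      case up
      have "\<not> \<ell> (s \<otimes> r \<otimes> s) < \<ell> (s \<otimes> r)"
        using asc(1) dich up by blast
      then have "factor_pairs {s} {t} b = {(\<one>, \<one>), (s, \<one>), (\<one>, t)}"
        using False neq up(2) by (auto simp: mem)
      then show ?thesis using False neq up by (simp add: r_def)
    next
      case down
      have "\<ell> (s \<otimes> r \<otimes> s) < \<ell> (s \<otimes> r)"
        using asc(1) dich down by blast
      then have "factor_pairs {s} {t} b = {(\<one>, \<one>), (s, \<one>), (s, t)}"
        using False neq down(2) by (auto simp: mem)
      then show ?thesis using False neq down by (simp add: r_def)
    qed
  qed
qed

lemma card_factor_pairs_empty:
  assumes "J \<subseteq> S" "b \<in> X_double W S {} J"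
  shows "card (factor_pairs {} J b) = card (factor_pairs J {} (inv b))"
  using factor_pairs_empty_left[of J b] factor_pairs_empty_right[of J "inv b"] assms
    X_doubleD[OF assms(2)] by (simp add: card_cartesian_product)

lemma card_factor_pairs_full:
  assumes "J \<subseteq> S" "b \<in> X_double W S S J"
  shows "card (factor_pairs S J b) = card (factor_pairs J S (inv b))"
proof -
  have "b = \<one>"
    using X_doubleD[OF assms(2)] X_set_full by (metis inv_inv inv_one singletonD)
  then show ?thesis
    using factor_pairs_full_left[of J] factor_pairs_full_right[of J] assms
    by (simp add: card_cartesian_product)
qed

text \<open>
  Both conditions in the count for singletons are symmetric under exchanging
  \<open>(s, t, b)\<close> with \<open>(t, s, b\<^sup>-\<^sup>1)\<close>: conjugation by \<open>b\<close> carries \<open>b\<^sup>-\<^sup>1 s b\<close> and \<open>t\<close> to \<open>s\<close> and \<open>b t b\<^sup>-\<^sup>1\<close>.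
\<close>

lemma card_factor_pairs_swap_singletons:
  assumes s: "s \<in> S" and t: "t \<in> S" and bX: "b \<in> X_double W S {s} {t}"
  shows "card (factor_pairs {s} {t} b) = card (factor_pairs {t} {s} (inv b))"
proof -
  have b: "b \<in> carrier W" using X_doubleD[OF bX] by simp
  have "t \<otimes> inv b = inv b \<otimes> s \<longleftrightarrow> inv (b \<otimes> t) = inv (s \<otimes> b)"
    using b s t by (simp add: inv_mult_group)
  also have "\<dots> \<longleftrightarrow> s \<otimes> b = b \<otimes> t"
    using b s t by (metis S_closed inv_inv m_closed)
  finally have 1: "t \<otimes> inv b = inv b \<otimes> s \<longleftrightarrow> s \<otimes> b = b \<otimes> t" .
  let ?q = "inv b \<otimes> s \<otimes> b" and ?r = "b \<otimes> t \<otimes> inv b"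
  have cancel: "b \<otimes> (inv b \<otimes> z) = z" "inv b \<otimes> (b \<otimes> z) = z" if "z \<in> carrier W" for z
    using that b by (simp_all add: m_assoc[symmetric])
  have "t \<otimes> ?q = ?q \<otimes> t \<longleftrightarrow> b \<otimes> (t \<otimes> ?q) \<otimes> inv b = b \<otimes> (?q \<otimes> t) \<otimes> inv b"
    using b s t by simp
  also have "\<dots> \<longleftrightarrow> s \<otimes> ?r = ?r \<otimes> s"
    using b s t by (auto simp: m_assoc cancel)
  finally have 2: "t \<otimes> ?q = ?q \<otimes> t \<longleftrightarrow> s \<otimes> ?r = ?r \<otimes> s" .
  show ?thesis
    using card_factor_pairs_singletons[OF s t bX]
      card_factor_pairs_singletons[OF t s X_double_inv[OF bX]] 1 2 b by simp
qed

lemma card_factor_pairs_swap: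
  assumes I: "I \<subseteq> S" and J: "J \<subseteq> S" and bX: "b \<in> X_double W S I J"
  shows "card (factor_pairs I J b) = card (factor_pairs J I (inv b))"
proof -
  have b: "inv (inv b) = b" using X_doubleD[OF bX] by simp
  note bX' = X_double_inv[OF bX]
  show ?thesis
    using I
  proof (cases rule: subset_S_cases)
    case 1
    then show ?thesis using card_factor_pairs_empty J bX by simp
  next
    case 2
    then show ?thesis using card_factor_pairs_full J bX by simp
  next
    case (3 s)
    note sI = this
    show ?thesis
      using J
    proof (cases rule: subset_S_cases)
      case 1
      then show ?thesis using card_factor_pairs_empty[of I "inv b"] I bX' b by simp
    next
      case 2
      then show ?thesis using card_factor_pairs_full[of I "inv b"] I bX' b by simp
    next
      case (3 t)
      then show ?thesis using card_factor_pairs_swap_singletons sI bX by simp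
    qed
  qed
qed

end

theorem corollary4p18:
  fixes W :: "('a, 'b) monoid_scheme" and S I J :: "'a set" and b :: 'a
  assumes "coxeter_system W S"
    and "finite (carrier W)"
    and "card S = 2"
    and "I \<subseteq> S" and "J \<subseteq> S"
    and "b \<in> X_double W S I J"
  shows "card (W_set W S I J b) = card (W_set W S J I (inv\<^bsub>W\<^esub> b))"
proof -
  interpret dihedral_system W S
    using assms(1,3) by (simp add: dihedral_system_def dihedral_system_axioms_def)
  have "b \<in> carrier W"
    using X_doubleD[OF assms(6)] by simp
  then show ?thesis
    using card_W_set card_factor_pairs_swap assms(4-6) by simp
qed

end
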